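(* Let $a,m,s,k$ be positive integers, let $r=1+2ams$, and set \[ D:=m\left(2r^k+m\left(s+ar^k\right)^2\right). \] Define $p_1,\dots,p_{2k}$ by $p_{2j+1}=ar^{j}$ and $p_{2j+2}=2amr^{k-1-j}$ for $0\le j\le k-1$ (so the sequence is $a,\,2amr^{k-1},\,ar,\,2amr^{k-2},\dots,ar^{k-1},\,2am$). Then $l(D)=4k+2$ and \[ \sqrt D=[m(s+ar^k);\overline{p_1,p_2,\dots,p_{2k},\,s+ar^k,\,p_{2k},\dots,p_2,p_1,\,2m(s+ar^k)}]. \]
   Context: For a positive non-square integer $D$, $l(D)$ denotes the length of the fundamental (shortest) period of the regular continued fraction expansion of $\sqrt D$. $[a_0;\overline{b_1,\dots,b_m}]$ denotes the regular continued fraction whose partial quotients after $a_0$ are the block $b_1,\dots,b_m$ repeated infinitely often. *)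

theory Defs
  imports Complex_Main
begin

text \<open>
  Complete quotients and partial quotients of the regular continued fraction expansion of a
  real number. These functions are total: if \<open>x\<close> is rational, the expansion stops at the first
  integral complete quotient, after which (since \<open>1 / 0 = 0\<close>) all entries are the junk value 0.
\<close>

fun complete_quotient :: "real \<Rightarrow> nat \<Rightarrow> real" where
  "complete_quotient x 0 = x"
| "complete_quotient x (Suc n) = 1 / frac (complete_quotient x n)"

definition partial_quotient :: "real \<Rightarrow> nat \<Rightarrow> int" where
  "partial_quotient x n = \<lfloor>complete_quotient x n\<rfloor>"

text \<open>
  A pre-period is allowed, as for any eventually periodic expansion (for \<open>sqrt D\<close> it
  consists of the integral part only).
\<close>

definition is_cf_period :: "real \<Rightarrow> nat \<Rightarrow> bool" where
  "is_cf_period x l \<longleftrightarrow>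
     l > 0 \<and> (\<exists>N. \<forall>n\<ge>N. partial_quotient x (n + l) = partial_quotient x n)"

text \<open>The length \<open>l(D)\<close>; only meaningful for positive non-square \<open>D\<close>.\<close>

definition cf_period_length :: "int \<Rightarrow> nat" where
  "cf_period_length D = (LEAST l. is_cf_period (sqrt (of_int D)) l)"

text \<open>The finite continued fraction \<open>[c 0; c 1, \<dots>, c n]\<close>.\<close>

fun cf_convergent :: "(nat \<Rightarrow> int) \<Rightarrow> nat \<Rightarrow> real" where
  "cf_convergent c 0 = of_int (c 0)"
| "cf_convergent c (Suc n) = of_int (c 0) + 1 / cf_convergent (\<lambda>i. c (Suc i)) n"

text \<open>\<open>x = [c 0; c 1, c 2, \<dots>]\<close> as an infinite regular continued fraction.\<close>

definition equals_regular_cf :: "real \<Rightarrow> (nat \<Rightarrow> int) \<Rightarrow> bool" where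
  "equals_regular_cf x c \<longleftrightarrow> (\<forall>n\<ge>1. c n \<ge> 1) \<and> cf_convergent c \<longlonglongrightarrow> x"

text \<open>The sequence \<open>a0, b1, \<dots>, bm, b1, \<dots>, bm, \<dots>\<close> for \<open>bs = [b1, \<dots>, bm]\<close> nonempty.\<close>

definition periodic_cf :: "int \<Rightarrow> int list \<Rightarrow> nat \<Rightarrow> int" where
  "periodic_cf a0 bs n = (if n = 0 then a0 else bs ! ((n - 1) mod length bs))"

end

theory Submission
  imports Defs
begin

text \<open>
  With \<open>A = s + a r\<^sup>k\<close> and \<open>w = \<surd>D\<close> all complete quotients can be written down explicitly:
  at even distance \<open>2j\<close> from the start of either half of the period they are
  \<open>(w + m A) / (c r\<^bsup>k-j\<^esup>)\<close>, at odd distance \<open>2j + 1\<close> they are \<open>(w + m (a r\<^sup>k - s)) / (d r\<^bsup>j+1\<^esup>)\<close>,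
  where \<open>(c, d) = (2m, 1)\<close> in the first half and \<open>(c, d) = (1, 2m)\<close> in the second. The recurrence
  between them rests on \<open>w\<^sup>2 - (m A)\<^sup>2 = 2 m r\<^sup>k\<close> and \<open>w\<^sup>2 - (m (a r\<^sup>k - s))\<^sup>2 = 2 m r\<^bsup>k+1\<^esup>\<close>. The period
  is shortest because its last entry \<open>2 m A\<close> exceeds all others.
\<close>

section \<open>Convergence of the regular continued fraction of an irrational number\<close>

text \<open>\<open>complete_quotient\<close> recurses at the far end of the expansion,
  \<open>cf_convergent\<close> at its first entry. Passing from \<open>x\<close> to
  \<open>1 / frac x\<close> reconciles the two and is what the inductions over arbitrary
  \<open>x\<close> use.\<close>

lemma complete_quotient_shift:
  "complete_quotient x (Suc n) = complete_quotient (1 / frac x) n"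
  by (induction n) auto

lemma partial_quotient_shift:
  "(\<lambda>n. partial_quotient x (Suc n)) = partial_quotient (1 / frac x)"
  unfolding partial_quotient_def complete_quotient_shift ..

lemma cf_convergent_ge_1:
  assumes "\<And>i. c i \<ge> 1"
  shows "cf_convergent c n \<ge> 1"
  using assms
proof (induction n arbitrary: c)
  case 0
  then show ?case by simp
next
  case (Suc n)
  have "cf_convergent (\<lambda>i. c (Suc i)) n \<ge> 1"
    by (rule Suc.IH) (rule Suc.prems)
  then have "1 / cf_convergent (\<lambda>i. c (Suc i)) n \<ge> 0" by simp
  moreover have "real_of_int (c 0) \<ge> 1"
    using Suc.prems[of 0] by simp
  ultimately show ?case unfolding cf_convergent.simps by linarith
qed

lemma frac_inverse_gt_1:
  fixes x :: real
  assumes "frac x \<noteq> 0"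
  shows "1 / frac x > 1"
  using assms frac_ge_0[of x] frac_lt_1[of x] by (simp add: less_divide_eq_1)

lemma partial_quotient_ge_1:
  assumes "frac (complete_quotient x n) \<noteq> 0"
  shows "partial_quotient x (Suc n) \<ge> 1"
  using frac_inverse_gt_1[OF assms] by (simp add: partial_quotient_def)

lemma real_eq_floor_plus_inverse: "(x::real) = of_int \<lfloor>x\<rfloor> + 1 / (1 / frac x)"
  by (simp add: frac_def)

lemma abs_diff_inverse:
  fixes x y :: real
  assumes "x > 0" and "y > 0"
  shows "\<bar>1 / x - 1 / y\<bar> = \<bar>x - y\<bar> / (x * y)"
proof -
  have "1 / x - 1 / y = (y - x) / (x * y)"
    using assms by (simp add: field_simps)
  then show ?thesis
    using assms by (simp add: abs_divide abs_minus_commute)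
qed

text \<open>A single step need not contract by a fixed factor, but two consecutive ones contract by 4.\<close>

lemma cf_convergent_error:
  assumes "\<And>n. frac (complete_quotient x n) \<noteq> 0"
  shows "\<bar>x - cf_convergent (partial_quotient x) n\<bar> \<le> 2 * (1 / 2) ^ n"
  using assms
proof (induction n arbitrary: x rule: induct_nat_012)
  case 0
  have "x - of_int \<lfloor>x\<rfloor> = frac x"
    by (simp add: frac_def)
  then show ?case
    using frac_ge_0[of x] frac_lt_1[of x] by (simp add: partial_quotient_def)
next
  case 1
  define y where "y = 1 / frac x"
  have y: "y > 1"
    using frac_inverse_gt_1 1[of 0] by (simp add: y_def)
  have fl: "real_of_int \<lfloor>y\<rfloor> \<ge> 1" using y by simp
  have x: "x = of_int \<lfloor>x\<rfloor> + 1 / y"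
    using real_eq_floor_plus_inverse by (simp add: y_def)
  have "cf_convergent (partial_quotient x) (Suc 0) = of_int \<lfloor>x\<rfloor> + 1 / of_int \<lfloor>y\<rfloor>"
    by (simp add: partial_quotient_def y_def)
  then have "x - cf_convergent (partial_quotient x) (Suc 0) = 1 / y - 1 / of_int \<lfloor>y\<rfloor>"
    using x by linarith
  moreover have "0 < 1 / y" "1 / y < 1" "0 < 1 / real_of_int \<lfloor>y\<rfloor>" "1 / real_of_int \<lfloor>y\<rfloor> \<le> 1"
    using y fl by auto
  ultimately have "\<bar>x - cf_convergent (partial_quotient x) (Suc 0)\<bar> \<le> 1" by linarith
  then show ?case by (simp del: cf_convergent.simps)
next
  case (ge2 n)
  define y where "y = 1 / frac x"
  define z where "z = 1 / frac y"
  have ynz: "frac (complete_quotient y i) \<noteq> 0" for i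
    using ge2.prems[of "Suc i"] unfolding complete_quotient_shift y_def .
  have znz: "frac (complete_quotient z i) \<noteq> 0" for i
    using ynz[of "Suc i"] unfolding complete_quotient_shift z_def .
  have y: "y > 1"
    using frac_inverse_gt_1 ge2.prems[of 0] by (simp add: y_def)
  have z: "z > 1"
    using frac_inverse_gt_1 ynz[of 0] by (simp add: z_def)
  \<comment> \<open>\<open>v\<close> is the convergent of order \<open>n\<close> of
    \<open>z\<close>, and \<open>u\<close> that of order \<open>n + 1\<close> of \<open>y\<close>.
    The integer parts cancel in \<open>x\<close> minus its convergent and in
    \<open>y - u\<close>.\<close>
  define v where "v = cf_convergent (partial_quotient z) n"
  define u where "u = of_int \<lfloor>y\<rfloor> + 1 / v"
  have xy: "x = of_int \<lfloor>x\<rfloor> + 1 / y" and yz: "y = of_int \<lfloor>y\<rfloor> + 1 / z"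
    using real_eq_floor_plus_inverse by (simp_all add: y_def z_def)
  have conv: "cf_convergent (partial_quotient x) (Suc (Suc n)) = of_int \<lfloor>x\<rfloor> + 1 / u"
    by (simp add: u_def v_def y_def[symmetric] z_def[symmetric] partial_quotient_shift)
      (simp add: partial_quotient_def y_def)
  have fl: "real_of_int \<lfloor>y\<rfloor> \<ge> 1" using y by simp
  have v: "v \<ge> 1"
    unfolding v_def
  proof (rule cf_convergent_ge_1)
    show "partial_quotient z i \<ge> 1" for i
      using partial_quotient_ge_1[OF ynz, of i] fun_cong[OF partial_quotient_shift, of y i]
      by (simp add: z_def)
  qed
  have u: "u > 0" using fl v by (simp add: u_def add_pos_pos)
  have uv: "u * v = of_int \<lfloor>y\<rfloor> * v + 1"
    using v by (simp add: u_def field_simps)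
  have "(of_int \<lfloor>y\<rfloor> + 1 / z) * z = of_int \<lfloor>y\<rfloor> * z + 1"
    using z by (simp add: distrib_right)
  then have yz': "y * z = of_int \<lfloor>y\<rfloor> * z + 1"
    using yz by metis
  \<comment> \<open>Each of \<open>y * z\<close> and \<open>u * v\<close> is a product that is at
    least 1, plus 1, hence at least 2. Together they give the factor 4, which matches two steps of
    \<open>(1 / 2) ^ n\<close>.\<close>
  have "1 * 1 \<le> of_int \<lfloor>y\<rfloor> * v" "1 * 1 \<le> of_int \<lfloor>y\<rfloor> * z"
    using fl v z by (intro mult_mono; simp)+
  then have "2 * 2 \<le> (y * z) * (u * v)"
    unfolding uv yz' by (intro mult_mono) auto
  then have four: "4 \<le> y * u * (z * v)" by (simp add: mult_ac)
  have "\<bar>x - cf_convergent (partial_quotient x) (Suc (Suc n))\<bar> = \<bar>1 / y - 1 / u\<bar>"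
    using conv xy by simp
  also have "\<dots> = \<bar>1 / z - 1 / v\<bar> / (y * u)"
    using abs_diff_inverse[of y u] y u yz by (simp add: u_def)
  also have "\<dots> = \<bar>z - v\<bar> / (y * u * (z * v))"
    using abs_diff_inverse[of z v] z v by simp
  also have "\<dots> \<le> \<bar>z - v\<bar> / 4"
    using four by (intro divide_left_mono) auto
  also have "\<dots> \<le> 2 * (1 / 2) ^ n / 4"
    using ge2.IH(1)[OF znz] by (simp add: v_def)
  finally show ?case by simp
qed

lemma cf_convergent_tendsto:
  assumes "\<And>n. frac (complete_quotient x n) \<noteq> 0"
  shows "cf_convergent (partial_quotient x) \<longlonglongrightarrow> x"
proof (rule metric_LIMSEQ_I)
  fix e :: real
  assume e: "e > 0"
  obtain N where N: "(1 / 2 :: real) ^ N < e / 2"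
    using real_arch_pow_inv[of "e / 2" "1 / 2"] e by auto
  have "dist (cf_convergent (partial_quotient x) n) x < e" if "n \<ge> N" for n
  proof -
    have "(1 / 2 :: real) ^ n \<le> (1 / 2) ^ N"
      using that by (intro power_decreasing) auto
    then show ?thesis
      using cf_convergent_error[OF assms, of n] N unfolding dist_real_def by linarith
  qed
  then show "\<exists>no. \<forall>n\<ge>no. dist (cf_convergent (partial_quotient x) n) x < e" by blast
qed

lemma equals_regular_cf_partial_quotient:
  assumes "\<And>n. frac (complete_quotient x n) \<noteq> 0"
  shows "equals_regular_cf x (partial_quotient x)"
  unfolding equals_regular_cf_def
proof (intro conjI allI impI)
  fix n :: nat
  assume "n \<ge> 1"
  then obtain i where "n = Suc i" using not0_implies_Suc by fastforce
  then show "partial_quotient x n \<ge> 1" using partial_quotient_ge_1[OF assms] by simp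
qed (rule cf_convergent_tendsto[OF assms])

section \<open>Recognising a periodic expansion from candidate complete quotients\<close>

lemma floor_frac_of_int_plus_inverse:
  fixes x y :: real
  assumes "x = of_int c + 1 / y" and "y > 1"
  shows "\<lfloor>x\<rfloor> = c" and "frac x = 1 / y"
proof -
  have "0 < 1 / y" "1 / y < 1" using assms(2) by auto
  then show "\<lfloor>x\<rfloor> = c" unfolding assms(1) by (simp add: floor_eq_iff)
  then show "frac x = 1 / y" using assms(1) by (simp add: frac_def)
qed

context
  fixes x :: real and a0 :: int and bs :: "int list" and y :: "nat \<Rightarrow> real"
  assumes ne: "bs \<noteq> []"
    and start: "x = of_int a0 + 1 / y 0"
    and step: "\<And>i. i < length bs \<Longrightarrow> y i = of_int (bs ! i) + 1 / y (Suc i mod length bs)"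
    and gt_1: "\<And>i. i < length bs \<Longrightarrow> y i > 1"
begin

text \<open>Since the next candidate exceeds 1, its reciprocal is the fractional part of the current
  one, so inverting moves one place around the cycle. The index is \<open>Suc n\<close> because
  complete quotient 0 is \<open>x\<close> itself.\<close>

lemma complete_quotient_periodic:
  "complete_quotient x (Suc n) = y (n mod length bs)"
proof (induction n)
  case 0
  show ?case
    using floor_frac_of_int_plus_inverse(2)[OF start] gt_1[of 0] ne by simp
next
  case (Suc n)
  have l: "n mod length bs < length bs" "Suc n mod length bs < length bs"
    using ne by simp_all
  have "frac (y (n mod length bs)) = 1 / y (Suc (n mod length bs) mod length bs)"
    using floor_frac_of_int_plus_inverse(2)[OF step[OF l(1)]] gt_1 ne by simp
  then show ?case
    using Suc.IH by (simp add: mod_Suc_eq)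
qed

lemma floor_frac_complete_quotient_periodic:
  "partial_quotient x n = periodic_cf a0 bs n \<and> frac (complete_quotient x n) \<noteq> 0"
proof (cases n)
  case 0
  then show ?thesis
    using floor_frac_of_int_plus_inverse[OF start] gt_1[of 0] ne
    by (simp add: partial_quotient_def periodic_cf_def)
next
  case (Suc i)
  have l: "i mod length bs < length bs" "Suc (i mod length bs) mod length bs < length bs"
    using ne by simp_all
  show ?thesis
    using floor_frac_of_int_plus_inverse[OF step[OF l(1)] gt_1[OF l(2)]] gt_1[OF l(2)]
      complete_quotient_periodic[of i] Suc
    by (simp add: partial_quotient_def periodic_cf_def del: complete_quotient.simps)
qed

lemma partial_quotient_periodic: "partial_quotient x = periodic_cf a0 bs"
  using floor_frac_complete_quotient_periodic by blast

lemma equals_regular_cf_periodic: "equals_regular_cf x (periodic_cf a0 bs)"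
  using equals_regular_cf_partial_quotient floor_frac_complete_quotient_periodic
    partial_quotient_periodic by metis

end

section \<open>Minimality of the period\<close>

text \<open>An entry that occurs only once in the block marks its residue class: a shift by any
  period \<open>l\<close> must carry a late occurrence to another one, so \<open>length bs\<close>
  divides \<open>l\<close>.\<close>

lemma Least_is_cf_period_eq:
  assumes pq: "partial_quotient x = periodic_cf a0 bs"
    and i: "i < length bs"
    and unique: "\<And>j. j < length bs \<Longrightarrow> bs ! j = bs ! i \<Longrightarrow> j = i"
  shows "(LEAST l. is_cf_period x l) = length bs"
proof (rule Least_equality)
  have "periodic_cf a0 bs (n + length bs) = periodic_cf a0 bs n" if "n \<ge> 1" for n
    using that by (cases n) (simp_all add: periodic_cf_def)
  then show "is_cf_period x (length bs)"
    unfolding is_cf_period_def pq using i by auto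
next
  fix l
  assume "is_cf_period x l"
  then obtain N where l: "l > 0"
    and N: "\<And>n. n \<ge> N \<Longrightarrow> periodic_cf a0 bs (n + l) = periodic_cf a0 bs n"
    unfolding is_cf_period_def pq by blast
  \<comment> \<open>An occurrence of the marked entry beyond the pre-period \<open>N\<close>. The
    \<open>Suc\<close> skips \<open>a0\<close> at index 0.\<close>
  define n where "n = Suc (i + length bs * N)"
  have "n \<ge> N" using i by (cases "length bs") (auto simp: n_def)
  then have "bs ! ((i + length bs * N + l) mod length bs) = bs ! i"
    using N[of n] i by (simp add: n_def periodic_cf_def)
  moreover have "length bs > 0" using i by (rule le_less_trans[OF le0])
  ultimately have "(i + length bs * N + l) mod length bs = i"
    by (intro unique mod_less_divisor)
  then have "(i + l) mod length bs = (i + 0) mod length bs"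
    using i by (metis add.commute add.left_commute add_0 mod_less mod_mult_self2)
  then have "length bs dvd l"
    by (metis add_diff_cancel_left' le_add1 add.right_neutral mod_eq_dvd_iff_nat)
  then show "length bs \<le> l"
    using l by (rule dvd_imp_le)
qed

text \<open>One step on a quadratic surd. In the applications \<open>N'\<close> is
  \<open>w - P\<close> and \<open>M\<close> is its conjugate \<open>w + P\<close>, so the second
  hypothesis factors the integer \<open>w\<^sup>2 - P\<^sup>2\<close> into the present denominator
  \<open>C\<close> and the next one \<open>E\<close>.\<close>

lemma divide_eq_plus_inverse:
  fixes N C M E q N' :: real
  assumes "N = q * C + N'" and "N' * M = C * E" and "C \<noteq> 0" and "M \<noteq> 0"
  shows "N / C = q + 1 / (M / E)"
proof -
  have "N' / C = E / M" using assms(2-4) by (simp add: frac_eq_eq mult_ac)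
  then show ?thesis using assms(1,3) by (simp add: add_divide_distrib)
qed

section \<open>The family of surds and its explicit complete quotients\<close>

locale sqrt_family =
  fixes a m s r :: int and k :: nat and w :: real
  assumes pos: "a > 0" "m > 0" "s > 0" "w > 0"
    and r: "r = 1 + 2 * a * m * s"
    and w2: "w\<^sup>2 = of_int (m * (2 * r ^ k + m * (s + a * r ^ k)\<^sup>2))"
begin

text \<open>\<open>m * A\<close> is the integer part of \<open>w\<close>, and \<open>A\<close>
  itself the middle entry of the period.\<close>

definition A :: int where
  "A = s + a * r ^ k"

text \<open>The parameters \<open>c\<close>, \<open>d\<close> let one calculation serve both halves
  of the period: only \<open>c * d = 2 * m\<close> and positivity matter, and the two are exchanged
  between the halves.\<close>

definition theta :: "int \<Rightarrow> int \<Rightarrow> nat \<Rightarrow> real" where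
  "theta c d u =
    (if even u then (w + of_int (m * A)) / of_int (c * r ^ (k - u div 2))
     else (w + of_int (m * (a * r ^ k - s))) / of_int (d * r ^ (u div 2 + 1)))"

text \<open>The entry that closes a half sits at the even position \<open>2 * k\<close> and is
  therefore tested first: it is \<open>A\<close> in the first half and \<open>2 * m * A\<close> in
  the second.\<close>

definition quot :: "int \<Rightarrow> int \<Rightarrow> nat \<Rightarrow> int" where
  "quot c d u =
    (if u = 2 * k then d * A
     else if even u then d * a * r ^ (u div 2)
     else c * a * r ^ (k - 1 - u div 2))"

lemma r_gt_1: "r > 1"
  using pos by (simp add: r)

lemma r_power_pos: "r ^ n > 0"
  using r_gt_1 by simp

lemma A_gt: "A > r ^ k" "A > a * r ^ k"
proof -
  have "1 * r ^ k \<le> a * r ^ k"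
    using pos r_power_pos[of k] by (intro mult_right_mono) auto
  then show "A > r ^ k" "A > a * r ^ k" using pos by (simp_all add: A_def)
qed

text \<open>The excess of \<open>w\<^sup>2\<close> over \<open>(m * A)\<^sup>2\<close> is
  \<open>2 * m * r ^ k\<close>. It is positive, and below \<open>2 * m * A + 1\<close> because
  \<open>r ^ k < A\<close>.\<close>

lemma w_bounds: "of_int (m * A) < w" "w < of_int (m * A) + 1"
proof -
  have A: "A > 0" using A_gt(1) r_power_pos[of k] by linarith
  have w2': "w\<^sup>2 = (of_int (m * A))\<^sup>2 + of_int (2 * (m * r ^ k))"
    unfolding w2 by (simp add: A_def algebra_simps power2_eq_square)
  have "m * r ^ k > 0" using pos r_power_pos[of k] by simp
  then have "(of_int (m * A))\<^sup>2 < w\<^sup>2" unfolding w2' by (simp del: of_int_mult of_int_power)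
  then show "of_int (m * A) < w"
    using pos by (rule_tac power_less_imp_less_base[of _ 2]) auto
  have "m * r ^ k < m * A" using A_gt pos by simp
  then have "real_of_int (2 * (m * r ^ k)) < of_int (2 * (m * A) + 1)" by linarith
  then have "w\<^sup>2 < (of_int (m * A) + 1)\<^sup>2"
    unfolding w2' power2_sum by simp
  moreover have "real_of_int (m * A) + 1 \<ge> 0" using pos A by simp
  ultimately show "w < of_int (m * A) + 1"
    using power_less_imp_less_base by blast
qed

lemma numerators_pos:
  "w + of_int (m * A) > 0" "w + of_int (m * (a * r ^ k - s)) > 0"
proof -
  have "m * A > 0" using pos A_gt(1) r_power_pos[of k] by simp
  then have "real_of_int (m * A) > 0" by linarith
  then show "w + of_int (m * A) > 0" using w_bounds(1) by linarith
  \<comment> \<open>Adding \<open>m * A\<close> cancels \<open>s\<close>, so the sign of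
    \<open>a * r ^ k - s\<close> need not be known.\<close>
  have "m * A + m * (a * r ^ k - s) = 2 * (m * (a * r ^ k))"
    by (simp add: A_def algebra_simps)
  moreover have "m * (a * r ^ k) > 0" using pos r_power_pos[of k] by simp
  ultimately have "real_of_int (m * A) + of_int (m * (a * r ^ k - s)) > 0"
    by linarith
  then show "w + of_int (m * (a * r ^ k - s)) > 0" using w_bounds(1) by linarith
qed

lemma conj_prod_A: "(w - of_int (m * A)) * (w + of_int (m * A)) = of_int (2 * m) * of_int r ^ k"
proof -
  have "(w - of_int (m * A)) * (w + of_int (m * A)) = w\<^sup>2 - (of_int (m * A))\<^sup>2"
    by (simp add: algebra_simps power2_eq_square)
  also have "\<dots> = of_int (2 * m) * of_int r ^ k"
    unfolding w2 by (simp add: A_def algebra_simps power2_eq_square)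
  finally show ?thesis .
qed

lemma conj_prod_diff:
  "(w - of_int (m * (a * r ^ k - s))) * (w + of_int (m * (a * r ^ k - s)))
    = of_int (2 * m) * of_int r * of_int r ^ k"
proof -
  have "(w - of_int (m * (a * r ^ k - s))) * (w + of_int (m * (a * r ^ k - s)))
      = w\<^sup>2 - (of_int (m * (a * r ^ k - s)))\<^sup>2"
    by (simp add: algebra_simps power2_eq_square)
  \<comment> \<open>The cross terms contribute \<open>4 * a * m\<^sup>2 * s * r ^ k\<close>; the
    choice of \<open>r\<close> turns the sum into one further power of \<open>r\<close>.\<close>
  also have "\<dots> = of_int (2 * m * (1 + 2 * a * m * s)) * of_int r ^ k"
    unfolding w2 by (simp add: algebra_simps power2_eq_square)
  finally show ?thesis by (simp flip: r)
qed

section \<open>The recurrence within one half of the period\<close>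

context
  fixes c d :: int
  assumes cd: "c * d = 2 * m" "c > 0" "d > 0"
begin

lemma cd_le: "c \<le> 2 * m" "d \<le> 2 * m"
proof -
  have "c * 1 \<le> c * d" "1 * d \<le> c * d"
    using cd(2,3) by (intro mult_mono; simp)+
  then show "c \<le> 2 * m" "d \<le> 2 * m" using cd(1) by simp_all
qed

text \<open>Every denominator is at most \<open>2 * m * r ^ k\<close>, as \<open>c\<close> and
  \<open>d\<close> divide \<open>2 * m\<close>, and both numerators are larger than that.\<close>

lemma theta_gt_1:
  assumes "u \<le> 2 * k"
  shows "theta c d u > 1"
proof (cases "even u")
  case True
  have "c * r ^ (k - u div 2) \<le> (2 * m) * r ^ k"
    using cd_le cd r_gt_1 pos by (intro mult_mono power_increasing) auto
  also have "\<dots> < 2 * m * A" using A_gt pos by simp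
  finally have "real_of_int (c * r ^ (k - u div 2)) < of_int (2 * (m * A))"
    by (simp add: mult.assoc del: of_int_mult)
  then show ?thesis
    using True w_bounds(1) cd r_power_pos[of "k - u div 2"]
    by (simp add: theta_def del: of_int_mult of_int_power)
next
  case False
  \<comment> \<open>An odd \<open>u\<close> is at most \<open>2 * k - 1\<close>, which keeps the
    exponent within \<open>k\<close>.\<close>
  then have "u div 2 + 1 \<le> k" using assms by (auto elim!: oddE)
  then have "d * r ^ (u div 2 + 1) \<le> (2 * m) * r ^ k"
    using cd_le cd r_gt_1 pos by (intro mult_mono power_increasing) auto
  also have "\<dots> \<le> (2 * m) * (a * r ^ k)"
    using pos r_power_pos[of k] by simp
  also have "\<dots> = m * A + m * (a * r ^ k - s)"
    by (simp add: A_def algebra_simps)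
  finally have "real_of_int (d * r ^ (u div 2 + 1)) \<le> of_int (m * A) + of_int (m * (a * r ^ k - s))"
    by linarith
  moreover have "d * r ^ (u div 2 + 1) > 0"
    using cd(3) r_power_pos by (rule mult_pos_pos)
  ultimately show ?thesis
    using False w_bounds(1)
    by (simp add: theta_def del: of_int_mult of_int_power of_int_diff)
qed

text \<open>Entry times denominator is \<open>2 * m * a * r ^ k\<close> for every \<open>j\<close>.
  Subtracting it from \<open>w + m * A\<close> leaves \<open>w - m * (a * r ^ k - s)\<close>, and
  the conjugate product \<open>2 * m * r ^ (k + 1)\<close> splits as \<open>c * r ^ (k - j)\<close>
  times \<open>d * r ^ (j + 1)\<close>.\<close>

lemma theta_step_even:
  assumes "j < k"
  shows "theta c d (2 * j) = of_int (quot c d (2 * j)) + 1 / theta c d (Suc (2 * j))"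
proof -
  have p: "real_of_int r ^ j * of_int r ^ (k - j) = of_int r ^ k"
    using assms by (simp flip: power_add)
  have "(w + of_int (m * A)) / of_int (c * r ^ (k - j)) = of_int (d * a * r ^ j) +
    1 / ((w + of_int (m * (a * r ^ k - s))) / of_int (d * r ^ (j + 1)))"
  proof (rule divide_eq_plus_inverse)
    have e: "real_of_int (d * a * r ^ j) * of_int (c * r ^ (k - j))
        = of_int (c * d) * of_int a * (of_int r ^ j * of_int r ^ (k - j))"
      by (simp add: mult_ac)
    show "w + of_int (m * A) = of_int (d * a * r ^ j) * of_int (c * r ^ (k - j))
        + (w - of_int (m * (a * r ^ k - s)))"
      unfolding e[unfolded p cd(1)] by (simp add: A_def algebra_simps)
    have e: "real_of_int (c * r ^ (k - j)) * of_int (d * r ^ (j + 1))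
        = of_int (c * d) * of_int r * (of_int r ^ j * of_int r ^ (k - j))"
      by (simp add: mult_ac)
    show "(w - of_int (m * (a * r ^ k - s))) * (w + of_int (m * (a * r ^ k - s)))
        = of_int (c * r ^ (k - j)) * of_int (d * r ^ (j + 1))"
      unfolding e[unfolded p cd(1)] by (rule conj_prod_diff)
  qed (use cd r_gt_1 numerators_pos in \<open>simp_all del: of_int_mult of_int_diff\<close>)
  then show ?thesis using assms by (simp add: theta_def quot_def)
qed

text \<open>The same subtraction of \<open>2 * m * a * r ^ k\<close> now leads back to
  \<open>w - m * A\<close>, with conjugate product \<open>2 * m * r ^ k\<close>.\<close>

lemma theta_step_odd:
  assumes "j < k"
  shows "theta c d (Suc (2 * j)) = of_int (quot c d (Suc (2 * j))) + 1 / theta c d (Suc (Suc (2 * j)))"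
proof -
  have "k = Suc j + (k - 1 - j)" using assms by simp
  then have p: "real_of_int r ^ (j + 1) * of_int r ^ (k - 1 - j) = of_int r ^ k"
    by (metis Suc_eq_plus1 power_add)
  have "(w + of_int (m * (a * r ^ k - s))) / of_int (d * r ^ (j + 1)) = of_int (c * a * r ^ (k - 1 - j)) +
    1 / ((w + of_int (m * A)) / of_int (c * r ^ (k - 1 - j)))"
  proof (rule divide_eq_plus_inverse)
    have e: "real_of_int (c * a * r ^ (k - 1 - j)) * of_int (d * r ^ (j + 1))
        = of_int (c * d) * of_int a * (of_int r ^ (j + 1) * of_int r ^ (k - 1 - j))"
      by (simp add: mult_ac)
    show "w + of_int (m * (a * r ^ k - s))
        = of_int (c * a * r ^ (k - 1 - j)) * of_int (d * r ^ (j + 1)) + (w - of_int (m * A))"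
      unfolding e[unfolded p cd(1)] by (simp add: A_def algebra_simps)
    have e: "real_of_int (d * r ^ (j + 1)) * of_int (c * r ^ (k - 1 - j))
        = of_int (c * d) * (of_int r ^ (j + 1) * of_int r ^ (k - 1 - j))"
      by (simp add: mult_ac)
    show "(w - of_int (m * A)) * (w + of_int (m * A))
        = of_int (d * r ^ (j + 1)) * of_int (c * r ^ (k - 1 - j))"
      unfolding e[unfolded p cd(1)] by (rule conj_prod_A)
  qed (use cd r_gt_1 numerators_pos in \<open>simp_all del: of_int_mult of_int_diff\<close>)
  moreover have "Suc (2 * j) \<noteq> 2 * k" by presburger
  ultimately show ?thesis by (simp add: theta_def quot_def)
qed

lemma theta_step:
  assumes "u < 2 * k"
  shows "theta c d u = of_int (quot c d u) + 1 / theta c d (Suc u)"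
proof (cases "even u")
  case True
  then show ?thesis using theta_step_even[of "u div 2"] assms by auto
next
  case False
  then show ?thesis using theta_step_odd[of "u div 2"] assms by auto
qed

text \<open>At the end of a half the denominator is \<open>c\<close> alone. The entry
  \<open>d * A\<close> removes \<open>2 * m * A\<close>, and the next denominator
  \<open>d * r ^ k\<close> is the initial one with \<open>c\<close> and \<open>d\<close>
  exchanged.\<close>

lemma theta_step_last:
  "theta c d (2 * k) = of_int (quot c d (2 * k)) + 1 / theta d c 0"
proof -
  have "(w + of_int (m * A)) / of_int c = of_int (d * A) +
    1 / ((w + of_int (m * A)) / of_int (d * r ^ k))"
  proof (rule divide_eq_plus_inverse)
    have "d * A * c = 2 * (m * A)" using cd(1) by (simp add: mult_ac)
    then have "real_of_int (d * A) * of_int c = of_int (2 * (m * A))"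
      by (simp flip: of_int_mult)
    then show "w + of_int (m * A) = of_int (d * A) * of_int c + (w - of_int (m * A))"
      by linarith
    have e: "real_of_int c * of_int (d * r ^ k) = of_int (c * d) * of_int r ^ k"
      by simp
    show "(w - of_int (m * A)) * (w + of_int (m * A)) = of_int c * of_int (d * r ^ k)"
      unfolding e[unfolded cd(1)] by (rule conj_prod_A)
  qed (use cd r_gt_1 numerators_pos in \<open>simp_all del: of_int_mult of_int_diff\<close>)
  then show ?thesis by (simp add: theta_def quot_def)
qed

text \<open>Such an entry is \<open>c\<close> or \<open>d\<close>, hence at most
  \<open>2 * m\<close>, times \<open>a * r ^ n\<close> with \<open>n \<le> k\<close>, and
  \<open>a * r ^ k < A\<close>.\<close>

lemma quot_less:
  assumes "u < 2 * k"
  shows "quot c d u < 2 * m * A"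
proof -
  obtain e n where e: "quot c d u = e * (a * r ^ n)" "e = c \<or> e = d" "n \<le> k"
  proof (cases "even u")
    case True
    then show ?thesis using that[of d "u div 2"] assms by (auto simp: quot_def)
  next
    case False
    then show ?thesis using that[of c "k - 1 - u div 2"] assms by (auto simp: quot_def)
  qed
  have "e * (a * r ^ n) \<le> (2 * m) * (a * r ^ k)"
    using e cd cd_le pos r_gt_1 by (intro mult_mono power_increasing) auto
  also have "\<dots> < 2 * m * A" using A_gt pos by simp
  finally show ?thesis using e by simp
qed

end

section \<open>The full period and the expansion of the square root\<close>

text \<open>The halves stand in the order in which the complete quotients deliver them;
  \<open>block_eq\<close> recovers the palindromic form.\<close>

definition block :: "int list" where
  "block = map (quot (2 * m) 1) [0..<2 * k + 1] @ map (quot 1 (2 * m)) [0..<2 * k + 1]"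

lemma length_block: "length block = 4 * k + 2"
  by (simp add: block_def)

lemma block_nth:
  "u \<le> 2 * k \<Longrightarrow> block ! u = quot (2 * m) 1 u"
  "u \<le> 2 * k \<Longrightarrow> block ! (2 * k + 1 + u) = quot 1 (2 * m) u"
  by (simp_all add: block_def nth_append del: upt_Suc)

definition theta_block :: "nat \<Rightarrow> real" where
  "theta_block i =
    (if i \<le> 2 * k then theta (2 * m) 1 i else theta 1 (2 * m) (i - (2 * k + 1)))"

lemma block_index_cases:
  assumes "i < length block"
  obtains "i \<le> 2 * k" | u where "i = 2 * k + 1 + u" "u \<le> 2 * k"
proof (cases "i \<le> 2 * k")
  case False
  then show ?thesis using assms that(2)[of "i - (2 * k + 1)"] by (simp add: length_block)
qed (rule that(1))

lemma theta_block_gt_1: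
  assumes "i < length block"
  shows "theta_block i > 1"
  using assms
proof (cases rule: block_index_cases)
  case 1
  then show ?thesis using theta_gt_1[of "2 * m" 1] pos by (simp add: theta_block_def)
next
  case (2 u)
  then show ?thesis using theta_gt_1[of 1 "2 * m"] pos by (simp add: theta_block_def)
qed

lemma theta_block_step:
  assumes "i < length block"
  shows "theta_block i = of_int (block ! i) + 1 / theta_block (Suc i mod length block)"
  using assms
proof (cases rule: block_index_cases)
  case 1
  have m: "Suc i mod length block = Suc i" using 1 by (simp add: length_block)
  show ?thesis
  proof (cases "i = 2 * k")
    case True
    then show ?thesis using theta_step_last[of "2 * m" 1] pos
      unfolding m by (simp add: theta_block_def block_nth)
  next
    case False
    then show ?thesis using 1 theta_step[of "2 * m" 1 i] pos
      unfolding m by (simp add: theta_block_def block_nth)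
  qed
next
  case (2 u)
  show ?thesis
  proof (cases "u = 2 * k")
    case True
    \<comment> \<open>The second exchange of \<open>c\<close> and \<open>d\<close> restores the
      initial pair and closes the cycle.\<close>
    have "Suc i mod length block = 0" using 2 True by (simp add: length_block)
    then show ?thesis using 2 True theta_step_last[of 1 "2 * m"] pos block_nth(2)[of u]
      by (simp add: theta_block_def)
  next
    case False
    have "Suc i mod length block = Suc i" using 2 False by (simp add: length_block)
    then show ?thesis using 2 False theta_step[of 1 "2 * m" u] pos block_nth(2)[of u]
      by (simp add: theta_block_def)
  qed
qed

lemma w_expansion: "w = of_int (m * A) + 1 / theta_block 0"
proof -
  \<comment> \<open>Denominator 1 makes the initial step an instance of the same surd
    pattern.\<close>
  have "w / 1 = of_int (m * A) + 1 / ((w + of_int (m * A)) / of_int (2 * m * r ^ k))"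
  proof (rule divide_eq_plus_inverse)
    show "w = of_int (m * A) * 1 + (w - of_int (m * A))" by simp
    show "(w - of_int (m * A)) * (w + of_int (m * A)) = 1 * of_int (2 * m * r ^ k)"
      using conj_prod_A by simp
  qed (use numerators_pos in simp_all)
  then show ?thesis by (simp add: theta_block_def theta_def)
qed

lemma block_ne: "block \<noteq> []"
  by (simp add: block_def)

lemma partial_quotient_block: "partial_quotient w = periodic_cf (m * A) block"
  by (rule partial_quotient_periodic[OF block_ne w_expansion theta_block_step theta_block_gt_1])

lemma equals_regular_cf_block: "equals_regular_cf w (periodic_cf (m * A) block)"
  by (rule equals_regular_cf_periodic[OF block_ne w_expansion theta_block_step theta_block_gt_1])

text \<open>The last entry is \<open>2 * m * A\<close>. The middle entry \<open>A\<close> is smaller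
  since \<open>2 * m > 1\<close>, and all others are smaller by \<open>quot_less\<close>; this marks
  the entry for the minimality argument.\<close>

lemma block_last_unique:
  assumes "i < length block" and "block ! i = block ! (4 * k + 1)"
  shows "i = 4 * k + 1"
  using assms(1)
proof (cases rule: block_index_cases)
  case 1
  have A: "A > 0" using A_gt(1) r_power_pos[of k] by linarith
  have "1 * A < (2 * m) * A" using pos A by (intro mult_strict_right_mono) auto
  then have "quot (2 * m) 1 i < 2 * m * A"
    using 1 pos quot_less[of "2 * m" 1 i] by (cases "i = 2 * k") (auto simp: quot_def)
  then show ?thesis
    using assms(2) 1 block_nth(2)[of "2 * k"] by (simp add: block_nth quot_def)
next
  case (2 u)
  have "quot 1 (2 * m) u = block ! i" using 2 block_nth(2) by simp
  also have "\<dots> = 2 * m * A"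
    using assms(2) block_nth(2)[of "2 * k"] by (simp add: quot_def)
  finally have "\<not> u < 2 * k" using quot_less[of 1 "2 * m" u] pos by auto
  then show ?thesis using 2 by simp
qed

lemma Least_is_cf_period_block: "(LEAST l. is_cf_period w l) = 4 * k + 2"
  using Least_is_cf_period_eq[OF partial_quotient_block _ block_last_unique]
  by (simp add: length_block)

lemma w_not_int: "w \<noteq> of_int t"
proof
  assume "w = of_int t"
  then have "m * A < t" "t < m * A + 1" using w_bounds by linarith+
  then show False by simp
qed

text \<open>Both halves are compared entrywise with \<open>p\<close>: position \<open>u\<close> of
  the first half holds \<open>p (Suc u)\<close>, position \<open>u\<close> of the second holds
  \<open>p (2 * k - u)\<close>. The parity of the index of \<open>p\<close> thus differs between the
  halves, in accordance with the exchange of \<open>c\<close> and \<open>d\<close>.\<close>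

lemma block_eq:
  assumes p1: "\<And>j. j < k \<Longrightarrow> p (2 * j + 1) = a * r ^ j"
    and p2: "\<And>j. j < k \<Longrightarrow> p (2 * j + 2) = 2 * a * m * r ^ (k - 1 - j)"
  shows "map p [1..<2 * k + 1] @ [A] @ rev (map p [1..<2 * k + 1]) @ [2 * m * A] = block"
proof -
  have fwd: "p (Suc u) = quot (2 * m) 1 u" if "u < 2 * k" for u
  proof (cases "even u")
    case True
    then show ?thesis using that p1[of "u div 2"] by (auto simp: quot_def)
  next
    case False
    then show ?thesis using that p2[of "u div 2"] by (auto simp: quot_def elim!: oddE)
  qed
  have bwd: "p (2 * k - u) = quot 1 (2 * m) u" if u: "u < 2 * k" for u
  proof (cases "even u")
    case True
    then obtain j where "u = 2 * j" ..
    \<comment> \<open>Reading backwards replaces \<open>j\<close> by \<open>k - 1 - j\<close>, so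
      the decreasing powers of \<open>r\<close> in \<open>p\<close> become increasing ones.\<close>
    moreover from this have "2 * (k - 1 - j) + 2 = 2 * k - u" "k - 1 - (k - 1 - j) = j"
      using u by simp_all
    ultimately show ?thesis using u p2[of "k - 1 - j"] by (simp add: quot_def)
  next
    case False
    then obtain j where j: "u = 2 * j + 1" ..
    then have "2 * (k - 1 - j) + 1 = 2 * k - u" using u by simp
    moreover have "u \<noteq> 2 * k" using u by simp
    ultimately show ?thesis using j u p1[of "k - 1 - j"] by (simp add: quot_def)
  qed
  have "map p [1..<2 * k + 1] = map (quot (2 * m) 1) [0..<2 * k]"
    using fwd by (intro nth_equalityI) (simp_all del: upt_Suc)
  then have "map p [1..<2 * k + 1] @ [A] = map (quot (2 * m) 1) [0..<2 * k + 1]"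
    by (simp add: quot_def)
  moreover have "rev (map p [1..<2 * k + 1]) = map (quot 1 (2 * m)) [0..<2 * k]"
    using bwd by (intro nth_equalityI) (simp_all add: rev_nth Suc_diff_Suc del: upt_Suc)
  then have "rev (map p [1..<2 * k + 1]) @ [2 * m * A] = map (quot 1 (2 * m)) [0..<2 * k + 1]"
    by (simp add: quot_def)
  ultimately show ?thesis unfolding block_def by (metis append.assoc)
qed

end

theorem theorem2:
  fixes a m s r D :: int and k :: nat and p :: "nat \<Rightarrow> int"
  assumes "a > 0" and "m > 0" and "s > 0" and "k > 0"
    and "r = 1 + 2 * a * m * s"
    and "D = m * (2 * r ^ k + m * (s + a * r ^ k)\<^sup>2)"
    and "\<And>j. j \<le> k - 1 \<Longrightarrow> p (2 * j + 1) = a * r ^ j"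
    and "\<And>j. j \<le> k - 1 \<Longrightarrow> p (2 * j + 2) = 2 * a * m * r ^ (k - 1 - j)"
  shows "\<not> (\<exists>t. D = t\<^sup>2) \<and>
    cf_period_length D = 4 * k + 2 \<and>
    equals_regular_cf (sqrt (of_int D))
      (periodic_cf (m * (s + a * r ^ k))
        (map p [1..<2 * k + 1] @ [s + a * r ^ k] @
         rev (map p [1..<2 * k + 1]) @ [2 * m * (s + a * r ^ k)]))"
proof -
  have r1: "r > 1" using assms(1-3,5) by simp
  then have "r ^ k > 0" by simp
  then have D: "D > 0"
    unfolding assms(6) using assms(2) by (intro mult_pos_pos add_pos_nonneg) auto
  interpret sqrt_family a m s r k "sqrt (of_int D)"
  proof
    show "(sqrt (of_int D))\<^sup>2 = real_of_int (m * (2 * r ^ k + m * (s + a * r ^ k)\<^sup>2))"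
      using D by (simp flip: assms(6))
  qed (use assms(1-3,5) D in simp_all)
  have "D \<noteq> t\<^sup>2" for t
    \<comment> \<open>The root of \<open>t\<^sup>2\<close> is \<open>\<bar>t\<bar>\<close>, whereas
      \<open>w\<close> lies strictly between consecutive integers.\<close>
    using w_not_int[of "\<bar>t\<bar>"] by auto
  moreover have "map p [1..<2 * k + 1] @ [s + a * r ^ k] @
      rev (map p [1..<2 * k + 1]) @ [2 * m * (s + a * r ^ k)] = block"
    using block_eq[of p] assms(4,7,8) unfolding A_def by simp
  ultimately show ?thesis
    using Least_is_cf_period_block equals_regular_cf_block
    by (simp add: cf_period_length_def A_def)
qed

end
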